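(* Assume that $(f,f';h)$ satisfies the basic assumptions with parameters $(M_f,M_h,\mu)$, let $M=M_f+M_h$, and let $(x_0,\lambda,\delta)\in\operatorname{dom}h\times\mathbb{R}_{++}\times\mathbb{R}_{++}$ satisfy $\lambda\le\delta/(2MM_f)$ (and hence $M_h<\infty$). Then every iteration index of RPB$(x_0,\lambda,\delta)$ is a serious one. As a consequence, if the set $C_{j+1}$ (which necessarily contains $x_j$) is always chosen to be $\{x_j\}$ in serious iterations, then RPB$(x_0,\lambda,\delta)$ reduces to CS-CS$(x_0,\lambda)$, i.e. its iterates $x_j$ are those generated by CS-CS$(x_0,\lambda)$.
   Context: Problem: $\phi^*:=\min\{\phi(x):=f(x)+h(x):x\in\mathbb{R}^n\}$. We say $(f,f';h)$ satisfies the basic assumptions with parameters $(M_f,M_h,\mu)\in\mathbb{R}_+\times[0,\infty]\times\mathbb{R}_+$ if: (i) $f,h:\mathbb{R}^n\to(-\infty,+\infty]$ are proper lower semicontinuous convex, $\operatorname{dom}h\subset\operatorname{dom}f$, and $f':\operatorname{dom}h\to\mathbb{R}^n$ satisfies $f'(x)\in\partial f(x)$ for all $x\in\operatorname{dom}h$; (ii) the set $X^*$ of minimizers of $\phi$ is nonempty; (iii) $h$ is $\mu$-convex, i.e. $h(\alpha z+(1-\alpha)u)\le\alpha h(z)+(1-\alpha)h(u)-\frac{\alpha(1-\alpha)\mu}{2}\|z-u\|^2$ for all $z,u\in\operatorname{dom}h$, $\alpha\in[0,1]$, and $\|f'(x)\|\le M_f$ for all $x\in\operatorname{dom}h$; (iv)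 $|h(u)-h(v)|\le M_h\|u-v\|$ for all $u,v\in\operatorname{dom}h$. Here $\|\cdot\|$ is the Euclidean norm. Method RPB$(x_0,\lambda,\delta)$ ($x_0\in\operatorname{dom}h$, $\lambda>0$, $\delta>0$). Set $x_0^c=\tilde x_0=x_0$, $C_1=\{x_0\}$. For $j=1,2,\dots$: let $f_j(u)=\max\{f(x)+\langle f'(x),u-x\rangle:x\in C_j\}$; let $x_j$ be the unique minimizer and $m_j$ the minimum value over $u\in\mathbb{R}^n$ of $f_j(u)+h(u)+\frac1{2\lambda}\|u-x_{j-1}^c\|^2$; let $\phi_j^\lambda:=\phi+\frac1{2\lambda}\|\cdot-x_{j-1}^c\|^2$; choose $\tilde x_j\in\operatorname{Argmin}\{\phi_j^\lambda(u):u\in\{x_j,\tilde x_{j-1}\}\}$; let $t_j:=\phi_j^\lambda(\tilde x_j)-m_j$. If $t_j\le\delta$ (iteration index $j$ is serious): choose any finite $C_{j+1}$ with $\{x_j\}\subset C_{j+1}\subset\{x_0,\dots,x_j\}$ and set $x_j^c=x_j$. Otherwise (iteration index $j$ is null): set $x_j^c=x_{j-1}^c$ and choose any $C_{j+1}$ with $A_j\cup\{x_j\}\subset C_{j+1}\subset C_j\cup\{x_j\}$, where $A_j:=\{x\in C_j:f(x)+\langle f'(x),x_j-x\rangle=f_j(x_j)\}$. Method CS-CS$(x_0,\lambda)$ (constant stepsize composite subgradient method): starting from $x_0\in\operatorname{dom}h$, for $j\ge1$, $$x_j=\operatorname*{argmin}_{u\in\mathbb{R}^n}\left\{f(x_{j-1})+\langle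 f'(x_{j-1}),u-x_{j-1}\rangle+h(u)+\frac1{2\lambda}\|u-x_{j-1}\|^2\right\}.$$
   Formalization: The parenthetical "hence M_h<∞" is proved only when M_f>0; if M_f=0 and M_h=∞ the product M·M_f is undefined (with 0·∞=0 the parenthetical fails, e.g. f=0, h=x²). The main claims are proved in that case too, with the stepsize condition read as void. *)

theory Defs
  imports "HOL-Analysis.Analysis"
begin

definition eff_dom :: "('a \<Rightarrow> ereal) \<Rightarrow> 'a set" where
  "eff_dom f = {x. f x < \<infinity>}"

definition proper_fun :: "('a \<Rightarrow> ereal) \<Rightarrow> bool" where
  "proper_fun f \<longleftrightarrow> (\<forall>x. f x \<noteq> -\<infinity>) \<and> eff_dom f \<noteq> {}"

definition lsc_fun :: "('a::topological_space \<Rightarrow> ereal) \<Rightarrow> bool" where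
  "lsc_fun f \<longleftrightarrow> (\<forall>x. f x \<le> Liminf (at x) f)"

(* Only used for functions without the value -\<infinity>; note that 0 * \<infinity> = 0 on ereal. *)
definition convex_fun :: "('a::real_vector \<Rightarrow> ereal) \<Rightarrow> bool" where
  "convex_fun f \<longleftrightarrow> (\<forall>x y. \<forall>\<alpha>\<in>{0..1::real}.
     f (\<alpha> *\<^sub>R x + (1 - \<alpha>) *\<^sub>R y) \<le> ereal \<alpha> * f x + ereal (1 - \<alpha>) * f y)"

definition subdiff :: "('a::real_inner \<Rightarrow> ereal) \<Rightarrow> 'a \<Rightarrow> 'a set" where
  "subdiff f x = {g. \<forall>u. f x + ereal (g \<bullet> (u - x)) \<le> f u}"

definition mu_convex :: "real \<Rightarrow> ('a::real_normed_vector \<Rightarrow> ereal) \<Rightarrow> bool" where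
  "mu_convex \<mu> h \<longleftrightarrow> (\<forall>z\<in>eff_dom h. \<forall>u\<in>eff_dom h. \<forall>\<alpha>\<in>{0..1::real}.
     h (\<alpha> *\<^sub>R z + (1 - \<alpha>) *\<^sub>R u)
       \<le> ereal \<alpha> * h z + ereal (1 - \<alpha>) * h u - ereal (\<alpha> * (1 - \<alpha>) * \<mu> / 2 * (norm (z - u))\<^sup>2))"

(* The map f' is total in HOL; only its values on the effective domain of h matter. *)
definition basic_assumptions ::
  "('a::euclidean_space \<Rightarrow> ereal) \<Rightarrow> ('a \<Rightarrow> 'a) \<Rightarrow> ('a \<Rightarrow> ereal) \<Rightarrow> real \<Rightarrow> ereal \<Rightarrow> real \<Rightarrow> bool" where
  "basic_assumptions f f' h Mf Mh \<mu> \<longleftrightarrow>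
     0 \<le> Mf \<and> 0 \<le> Mh \<and> 0 \<le> \<mu> \<and>
     proper_fun f \<and> lsc_fun f \<and> convex_fun f \<and>
     proper_fun h \<and> lsc_fun h \<and> convex_fun h \<and>
     eff_dom h \<subseteq> eff_dom f \<and>
     (\<forall>x\<in>eff_dom h. f' x \<in> subdiff f x) \<and>
     {x. is_arg_min (\<lambda>u. f u + h u) (\<lambda>_. True) x} \<noteq> {} \<and>
     mu_convex \<mu> h \<and>
     (\<forall>x\<in>eff_dom h. norm (f' x) \<le> Mf) \<and>
     (\<forall>u\<in>eff_dom h. \<forall>v\<in>eff_dom h. \<bar>h u - h v\<bar> \<le> Mh * ereal (norm (u - v)))"

definition is_unique_minimizer :: "('a \<Rightarrow> ereal) \<Rightarrow> 'a \<Rightarrow> bool" where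
  "is_unique_minimizer F x \<longleftrightarrow>
     is_arg_min F (\<lambda>_. True) x \<and> (\<forall>y. is_arg_min F (\<lambda>_. True) y \<longrightarrow> y = x)"

definition prox_add :: "real \<Rightarrow> 'a::real_normed_vector \<Rightarrow> ('a \<Rightarrow> ereal) \<Rightarrow> 'a \<Rightarrow> ereal" where
  "prox_add lam c F u = F u + ereal (1 / (2 * lam) * (norm (u - c))\<^sup>2)"

definition linearization ::
  "('a::real_inner \<Rightarrow> ereal) \<Rightarrow> ('a \<Rightarrow> 'a) \<Rightarrow> 'a \<Rightarrow> 'a \<Rightarrow> ereal" where
  "linearization f f' x u = f x + ereal (f' x \<bullet> (u - x))"

definition cut_model ::
  "('a::real_inner \<Rightarrow> ereal) \<Rightarrow> ('a \<Rightarrow> 'a) \<Rightarrow> 'a set \<Rightarrow> 'a \<Rightarrow> ereal" where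
  "cut_model f f' C u = Max ((\<lambda>x. linearization f f' x u) ` C)"

definition rpb_subproblem ::
  "('a::real_inner \<Rightarrow> ereal) \<Rightarrow> ('a \<Rightarrow> 'a) \<Rightarrow> ('a \<Rightarrow> ereal) \<Rightarrow> real \<Rightarrow>
   (nat \<Rightarrow> 'a) \<Rightarrow> (nat \<Rightarrow> 'a set) \<Rightarrow> nat \<Rightarrow> 'a \<Rightarrow> ereal" where
  "rpb_subproblem f f' h lam xc C j = prox_add lam (xc (j - 1)) (\<lambda>u. cut_model f f' (C j) u + h u)"

definition rpb_phi ::
  "('a::real_normed_vector \<Rightarrow> ereal) \<Rightarrow> ('a \<Rightarrow> ereal) \<Rightarrow> real \<Rightarrow> (nat \<Rightarrow> 'a) \<Rightarrow> nat \<Rightarrow> 'a \<Rightarrow> ereal" where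
  "rpb_phi f h lam xc j = prox_add lam (xc (j - 1)) (\<lambda>u. f u + h u)"

definition rpb_gap ::
  "('a::real_inner \<Rightarrow> ereal) \<Rightarrow> ('a \<Rightarrow> 'a) \<Rightarrow> ('a \<Rightarrow> ereal) \<Rightarrow> real \<Rightarrow>
   (nat \<Rightarrow> 'a) \<Rightarrow> (nat \<Rightarrow> 'a) \<Rightarrow> (nat \<Rightarrow> 'a set) \<Rightarrow> nat \<Rightarrow> ereal" where
  "rpb_gap f f' h lam xc xt C j =
     rpb_phi f h lam xc j (xt j) - (INF u. rpb_subproblem f f' h lam xc C j u)"

definition rpb_serious ::
  "('a::real_inner \<Rightarrow> ereal) \<Rightarrow> ('a \<Rightarrow> 'a) \<Rightarrow> ('a \<Rightarrow> ereal) \<Rightarrow> real \<Rightarrow> real \<Rightarrow>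
   (nat \<Rightarrow> 'a) \<Rightarrow> (nat \<Rightarrow> 'a) \<Rightarrow> (nat \<Rightarrow> 'a set) \<Rightarrow> nat \<Rightarrow> bool" where
  "rpb_serious f f' h lam \<delta> xc xt C j \<longleftrightarrow> rpb_gap f f' h lam xc xt C j \<le> ereal \<delta>"

(* The method leaves choices open, so it is modelled by the set of its possible runs: sequences of
   iterates x, prox-centers xc, auxiliary points xt (x tilde) and bundles C obeying its rules.
   The value C 0 is unused. *)
definition rpb_run ::
  "('a::real_inner \<Rightarrow> ereal) \<Rightarrow> ('a \<Rightarrow> 'a) \<Rightarrow> ('a \<Rightarrow> ereal) \<Rightarrow> 'a \<Rightarrow> real \<Rightarrow> real \<Rightarrow>
   (nat \<Rightarrow> 'a) \<Rightarrow> (nat \<Rightarrow> 'a) \<Rightarrow> (nat \<Rightarrow> 'a) \<Rightarrow> (nat \<Rightarrow> 'a set) \<Rightarrow> bool" where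
  "rpb_run f f' h x0 lam \<delta> x xc xt C \<longleftrightarrow>
     x 0 = x0 \<and> xc 0 = x0 \<and> xt 0 = x0 \<and> C 1 = {x0} \<and>
     (\<forall>j\<ge>1.
        is_unique_minimizer (rpb_subproblem f f' h lam xc C j) (x j) \<and>
        is_arg_min (rpb_phi f h lam xc j) (\<lambda>u. u \<in> {x j, xt (j - 1)}) (xt j) \<and>
        (if rpb_serious f f' h lam \<delta> xc xt C j
         then finite (C (j + 1)) \<and> {x j} \<subseteq> C (j + 1) \<and> C (j + 1) \<subseteq> x ` {0..j} \<and> xc j = x j
         else xc j = xc (j - 1) \<and>
              {z \<in> C j. linearization f f' z (x j) = cut_model f f' (C j) (x j)} \<union> {x j} \<subseteq> C (j + 1) \<and>
              C (j + 1) \<subseteq> C j \<union> {x j}))"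

definition cscs_run ::
  "('a::real_inner \<Rightarrow> ereal) \<Rightarrow> ('a \<Rightarrow> 'a) \<Rightarrow> ('a \<Rightarrow> ereal) \<Rightarrow> 'a \<Rightarrow> real \<Rightarrow> (nat \<Rightarrow> 'a) \<Rightarrow> bool" where
  "cscs_run f f' h x0 lam x \<longleftrightarrow>
     x 0 = x0 \<and>
     (\<forall>j\<ge>1. is_unique_minimizer
        (prox_add lam (x (j - 1)) (\<lambda>u. linearization f f' (x (j - 1)) u + h u)) (x j))"

end

theory Submission
  imports Defs
begin

text \<open>
  Consider an iteration whose prox-center \<open>c\<close> is itself a point of the bundle, and let \<open>p\<close> be the
  new iterate, at distance \<open>d\<close> from \<open>c\<close>.  The gap is at most the error of the model at \<open>p\<close>, which is
  at most the error of the single cut taken at \<open>c\<close>; comparing this cut with the subgradient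
  inequality at \<open>p\<close> bounds the error by \<open>\<langle>f' p - f' c, p - c\<rangle> \<le> 2 * Mf * d\<close>
  (\<open>linearization_error\<close>, \<open>gap_le_step_length\<close>).  On the other hand, model plus \<open>h\<close> is
  \<open>(Mf + Mh)\<close>-Lipschitz on the convex set \<open>dom h\<close>, and a proximal step of stepsize \<open>lam\<close> on an
  \<open>L\<close>-Lipschitz function moves by at most \<open>lam * L\<close> (\<open>prox_step_length\<close>).  So the gap is at most
  \<open>2 * Mf * lam * M \<le> \<delta>\<close>: the iteration is serious.  The case \<open>Mh = \<infinity>\<close> can only occur with
  \<open>Mf = 0\<close>, and then the first bound is already zero (\<open>stepsize_cases\<close>).

  A serious iteration moves the prox-center to the new iterate and puts that iterate into the next
  bundle, so the situation reproduces itself and every iteration is serious by induction.  If each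
  bundle is just the last iterate, the model is a single linearization and the subproblems of both
  methods coincide; uniqueness of their minimizers identifies the runs.
\<close>

section \<open>Length of a proximal step\<close>

text \<open>Compare the minimizer \<open>p\<close> with the point a fraction \<open>\<alpha>\<close> of the way from \<open>p\<close> to the
  center: the quadratic term drops by \<open>\<alpha> (2 - \<alpha>) d\<^sup>2 / (2 * lam)\<close> while \<open>G\<close> rises by at most
  \<open>L * \<alpha> * d\<close>.  Letting \<open>\<alpha>\<close> tend to \<open>0\<close> recovers the factor \<open>2\<close> that the direct comparison with
  the center (\<open>\<alpha> = 1\<close>) would lose.\<close>

lemma prox_step_length:
  fixes G :: "'a::real_normed_vector \<Rightarrow> real"
  assumes "convex S" "c \<in> S" "p \<in> S" "0 < lam" "0 \<le> L"
    and lip: "\<And>u. u \<in> S \<Longrightarrow> G u - G p \<le> L * norm (u - p)"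
    and min: "\<And>u. u \<in> S \<Longrightarrow>
      G p + 1 / (2 * lam) * (norm (p - c))\<^sup>2 \<le> G u + 1 / (2 * lam) * (norm (u - c))\<^sup>2"
  shows "norm (p - c) \<le> lam * L"
proof -
  let ?d = "norm (p - c)"
  have step: "(2 - \<alpha>) * ?d \<le> 2 * lam * L" if \<alpha>: "0 < \<alpha>" "\<alpha> < 1" for \<alpha>
  proof (cases "?d = 0")
    case True
    then show ?thesis using assms by simp
  next
    case False
    define u where "u = (1 - \<alpha>) *\<^sub>R p + \<alpha> *\<^sub>R c"
    have "u \<in> S"
      unfolding u_def using assms \<alpha> by (intro convexD) auto
    have "u - c = (1 - \<alpha>) *\<^sub>R (p - c)" "u - p = \<alpha> *\<^sub>R (c - p)"
      by (simp_all add: u_def algebra_simps)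
    then have nu: "norm (u - c) = (1 - \<alpha>) * ?d" "norm (u - p) = \<alpha> * ?d"
      using \<alpha> by (simp_all add: norm_minus_commute)
    have "1 / (2 * lam) * (?d\<^sup>2 - ((1 - \<alpha>) * ?d)\<^sup>2) \<le> L * (\<alpha> * ?d)"
      using lip[OF \<open>u \<in> S\<close>] min[OF \<open>u \<in> S\<close>] unfolding nu by (simp add: right_diff_distrib)
    then have "?d\<^sup>2 - ((1 - \<alpha>) * ?d)\<^sup>2 \<le> 2 * lam * (L * (\<alpha> * ?d))"
      using \<open>0 < lam\<close> by (simp add: field_simps)
    also have "?d\<^sup>2 - ((1 - \<alpha>) * ?d)\<^sup>2 = (\<alpha> * ?d) * ((2 - \<alpha>) * ?d)"
      by (simp add: power2_eq_square algebra_simps)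
    finally have "(\<alpha> * ?d) * ((2 - \<alpha>) * ?d) \<le> (\<alpha> * ?d) * (2 * lam * L)"
      by (simp add: mult_ac)
    then show ?thesis
      using False \<alpha> by (subst (asm) mult_le_cancel_left_pos) auto
  qed
  have "2 * ?d \<le> 2 * lam * L"
  proof (rule tendsto_le[of "at_right (0::real)"])
    show "((\<lambda>\<alpha>::real. (2 - \<alpha>) * ?d) \<longlongrightarrow> 2 * ?d) (at_right 0)"
      by (auto intro!: tendsto_eq_intros)
    show "eventually (\<lambda>\<alpha>. (2 - \<alpha>) * ?d \<le> 2 * lam * L) (at_right (0::real))"
      using step by (intro eventually_mono[OF eventually_at_right_real[of 0 1]]) auto
  qed auto
  then show ?thesis by simp
qed

section \<open>Effective domains and cutting-plane models\<close>

text \<open>A constant of its own keeps \<open>f x = ereal (finite_value f x)\<close> usable as a rewrite rule: with the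
  body unfolded, the right-hand side would contain the left-hand side.\<close>

definition finite_value :: "('a \<Rightarrow> ereal) \<Rightarrow> 'a \<Rightarrow> real" where
  "finite_value f x = real_of_ereal (f x)"

lemma proper_fun_finite_value:
  assumes "proper_fun f" "x \<in> eff_dom f"
  shows "f x = ereal (finite_value f x)"
  using assms by (cases "f x") (auto simp: proper_fun_def eff_dom_def finite_value_def)

lemma convex_eff_dom:
  assumes "proper_fun h" "convex_fun h"
  shows "convex (eff_dom h)"
proof (rule convexI)
  fix x y and u v :: real
  assume xy: "x \<in> eff_dom h" "y \<in> eff_dom h" and uv: "0 \<le> u" "0 \<le> v" "u + v = 1"
  have "h (u *\<^sub>R x + v *\<^sub>R y) \<le> ereal u * h x + ereal v * h y"
  proof -
    have "u \<in> {0..1}" "v = 1 - u" using uv by auto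
    then show ?thesis using assms(2) unfolding convex_fun_def by blast
  qed
  also have "\<dots> < \<infinity>"
    unfolding xy[THEN proper_fun_finite_value[OF assms(1)]] by simp
  finally show "u *\<^sub>R x + v *\<^sub>R y \<in> eff_dom h"
    by (simp add: eff_dom_def)
qed

lemma cut_model_real:
  assumes "finite C" "C \<noteq> {}" "\<And>z. z \<in> C \<Longrightarrow> f z = ereal (r z)"
  shows "cut_model f f' C u = ereal (Max ((\<lambda>z. r z + f' z \<bullet> (u - z)) ` C))"
proof -
  have "(\<lambda>z. linearization f f' z u) ` C = ereal ` (\<lambda>z. r z + f' z \<bullet> (u - z)) ` C"
    using assms(3) by (force simp: linearization_def image_image)
  then show ?thesis
    unfolding cut_model_def using assms
    by (simp add: mono_Max_commute[symmetric] mono_def)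
qed

lemma Max_affine_lipschitz:
  fixes g :: "'a::real_inner \<Rightarrow> 'a"
  assumes "finite C" "C \<noteq> {}" "\<And>z. z \<in> C \<Longrightarrow> norm (g z) \<le> B"
  shows "Max ((\<lambda>z. r z + g z \<bullet> (u - z)) ` C) - Max ((\<lambda>z. r z + g z \<bullet> (v - z)) ` C)
    \<le> B * norm (u - v)"
proof -
  let ?m = "\<lambda>w. Max ((\<lambda>z. r z + g z \<bullet> (w - z)) ` C)"
  have "r z + g z \<bullet> (u - z) \<le> ?m v + B * norm (u - v)" if "z \<in> C" for z
  proof -
    have "r z + g z \<bullet> (u - z) = (r z + g z \<bullet> (v - z)) + g z \<bullet> (u - v)"
      by (simp add: inner_diff_right)
    moreover have "r z + g z \<bullet> (v - z) \<le> ?m v"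
      using assms that by (intro Max_ge) auto
    moreover have "g z \<bullet> (u - v) \<le> norm (g z) * norm (u - v)"
      by (rule norm_cauchy_schwarz)
    moreover have "\<dots> \<le> B * norm (u - v)"
      using assms(3)[OF that] by (intro mult_right_mono) auto
    ultimately show ?thesis by linarith
  qed
  then have "?m u \<le> ?m v + B * norm (u - v)"
    using assms by (intro Max.boundedI) auto
  then show ?thesis by linarith
qed

text \<open>The subgradient inequality at \<open>p\<close>, read at \<open>c\<close>, turns the error of the linearization at \<open>c\<close>
  into an inner product with a difference of two subgradients.\<close>

lemma linearization_error:
  fixes f :: "'a::real_inner \<Rightarrow> ereal"
  assumes fc: "f c = ereal a" and fp: "f p = ereal b" and "f' p \<in> subdiff f p"
    and "norm (f' p) \<le> B" "norm (f' c) \<le> B"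
  shows "b - (a + f' c \<bullet> (p - c)) \<le> 2 * B * norm (p - c)"
proof -
  have "f p + ereal (f' p \<bullet> (c - p)) \<le> f c"
    using assms(3) by (simp add: subdiff_def)
  then have "b + f' p \<bullet> (c - p) \<le> a"
    by (simp add: fc fp)
  then have "b - (a + f' c \<bullet> (p - c)) \<le> (f' p - f' c) \<bullet> (p - c)"
    by (simp add: inner_diff_left inner_diff_right)
  also have "\<dots> \<le> norm (f' p - f' c) * norm (p - c)"
    by (rule norm_cauchy_schwarz)
  also have "\<dots> \<le> (2 * B) * norm (p - c)"
    using norm_triangle_ineq4[of "f' p" "f' c"] assms(4,5)
    by (intro mult_right_mono) auto
  finally show ?thesis .
qed

section \<open>One iteration whose prox-center lies in the bundle\<close>

lemma is_arg_min_UNIV_iff: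
  fixes F :: "'a \<Rightarrow> 'b::linorder"
  shows "is_arg_min F (\<lambda>_. True) x \<longleftrightarrow> (\<forall>u. F x \<le> F u)"
  by (auto simp: is_arg_min_linorder)

lemma INF_eq_arg_min:
  fixes F :: "'a \<Rightarrow> ereal"
  assumes "is_arg_min F (\<lambda>_. True) p"
  shows "(INF u. F u) = F p"
  using assms unfolding is_arg_min_UNIV_iff
  by (intro antisym INF_lower INF_greatest) auto

lemma basic_assumptionsD:
  assumes "basic_assumptions f f' h Mf Mh \<mu>"
  shows "0 \<le> Mf" "0 \<le> Mh" "proper_fun f" "proper_fun h" "convex_fun h"
    and "eff_dom h \<subseteq> eff_dom f"
    and "\<And>x. x \<in> eff_dom h \<Longrightarrow> f' x \<in> subdiff f x"
    and "\<And>x. x \<in> eff_dom h \<Longrightarrow> norm (f' x) \<le> Mf"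
    and "\<And>u v. u \<in> eff_dom h \<Longrightarrow> v \<in> eff_dom h \<Longrightarrow> \<bar>h u - h v\<bar> \<le> Mh * ereal (norm (u - v))"
  using assms unfolding basic_assumptions_def by blast+

context
  fixes f h :: "'a::euclidean_space \<Rightarrow> ereal" and f' Mf Mh \<mu> lam C c p
  assumes basic: "basic_assumptions f f' h Mf Mh \<mu>"
    and lam: "0 < lam"
    and C: "finite C" "C \<subseteq> eff_dom h" "c \<in> C"
    and p: "is_arg_min (prox_add lam c (\<lambda>u. cut_model f f' C u + h u)) (\<lambda>_. True) p"
begin

private abbreviation (input) "rf \<equiv> finite_value f"
private abbreviation (input) "rh \<equiv> finite_value h"
private abbreviation (input) "model \<equiv> \<lambda>u. Max ((\<lambda>z. rf z + f' z \<bullet> (u - z)) ` C)"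

private lemma h_real: "u \<in> eff_dom h \<Longrightarrow> h u = ereal (rh u)"
  using basic_assumptionsD(4)[OF basic] by (rule proper_fun_finite_value)

private lemma f_real: "u \<in> eff_dom h \<Longrightarrow> f u = ereal (rf u)"
  using basic_assumptionsD(3,6)[OF basic] by (auto intro: proper_fun_finite_value)

private lemma cut_model_eq: "cut_model f f' C u = ereal (model u)"
  using C f_real by (intro cut_model_real) auto

private lemma c_dom: "c \<in> eff_dom h"
  using C by blast

lemma minimizer_in_eff_dom: "p \<in> eff_dom h"
proof -
  let ?F = "prox_add lam c (\<lambda>u. cut_model f f' C u + h u)"
  have "?F p \<le> ?F c"
    using p by (simp add: is_arg_min_UNIV_iff)
  also have "\<dots> < \<infinity>"
    unfolding prox_add_def cut_model_eq h_real[OF c_dom] by simp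
  finally show ?thesis
    by (auto simp: prox_add_def cut_model_eq eff_dom_def)
qed

lemma minimizer_step_length:
  assumes "Mh = ereal L"
  shows "norm (p - c) \<le> lam * (Mf + L)"
proof (rule prox_step_length[where S = "eff_dom h" and G = "\<lambda>u. model u + rh u"])
  show "convex (eff_dom h)"
    using basic_assumptionsD[OF basic] by (intro convex_eff_dom)
  show "0 \<le> Mf + L"
    using basic_assumptionsD(1,2)[OF basic] assms by simp
next
  fix u assume u: "u \<in> eff_dom h"
  have "model u - model p \<le> Mf * norm (u - p)"
    using C basic_assumptionsD(8)[OF basic] by (intro Max_affine_lipschitz) auto
  moreover have "\<bar>rh u - rh p\<bar> \<le> L * norm (u - p)"
    using basic_assumptionsD(9)[OF basic u minimizer_in_eff_dom] assms
    unfolding h_real[OF u] h_real[OF minimizer_in_eff_dom] by simp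
  ultimately show "(model u + rh u) - (model p + rh p) \<le> (Mf + L) * norm (u - p)"
    by (simp add: distrib_right)
  have "prox_add lam c (\<lambda>u. cut_model f f' C u + h u) p
      \<le> prox_add lam c (\<lambda>u. cut_model f f' C u + h u) u"
    using p by (simp add: is_arg_min_UNIV_iff)
  then show "model p + rh p + 1 / (2 * lam) * (norm (p - c))\<^sup>2
      \<le> model u + rh u + 1 / (2 * lam) * (norm (u - c))\<^sup>2"
    unfolding prox_add_def cut_model_eq h_real[OF u] h_real[OF minimizer_in_eff_dom] by simp
qed (use c_dom minimizer_in_eff_dom lam in auto)

text \<open>The terms \<open>h\<close> and the proximal term cancel, leaving the error of the model at \<open>p\<close>, which
  the cut at \<open>c\<close> controls.\<close>

lemma gap_le_step_length:
  "prox_add lam c (\<lambda>u. f u + h u) p - (INF u. prox_add lam c (\<lambda>u. cut_model f f' C u + h u) u)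
    \<le> ereal (2 * Mf * norm (p - c))"
proof -
  note pd = minimizer_in_eff_dom
  have "rf c + f' c \<bullet> (p - c) \<le> model p"
    using C by (intro Max_ge) auto
  moreover have "rf p - (rf c + f' c \<bullet> (p - c)) \<le> 2 * Mf * norm (p - c)"
    using basic_assumptionsD(7,8)[OF basic] pd c_dom f_real
    by (intro linearization_error[where f = f]) auto
  ultimately have "rf p - model p \<le> 2 * Mf * norm (p - c)"
    by linarith
  then show ?thesis
    unfolding INF_eq_arg_min[OF p]
    unfolding prox_add_def cut_model_eq h_real[OF pd] f_real[OF pd] by simp
qed

end

section \<open>Small stepsizes\<close>

text \<open>If \<open>Mh\<close> is infinite and \<open>Mf\<close> is not zero, then the quotient is zero and there is no positive
  stepsize.  If \<open>Mf = 0\<close>, then \<open>Mf * \<infinity> = 0\<close> and \<open>\<delta> / 0 = \<infinity>\<close> make the stepsize condition void,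
  as the bound on the gap is then zero whatever the step length.\<close>

lemma stepsize_cases:
  fixes Mh :: ereal
  assumes "0 < lam" "0 < \<delta>" "0 \<le> Mf" "0 \<le> Mh"
    and le: "ereal lam \<le> ereal \<delta> / (2 * (ereal Mf + Mh) * ereal Mf)"
  obtains "Mf = 0" | L where "Mh = ereal L" "0 < Mf" "2 * Mf * (lam * (Mf + L)) \<le> \<delta>"
proof (cases "Mf = 0")
  case False
  then have Mf: "0 < Mf" using assms by simp
  show thesis
  proof (cases Mh)
    case (real L)
    have "0 < Mf + L" using Mf real assms by simp
    have num: "(2::ereal) = ereal 2" by simp
    have "lam \<le> \<delta> / (2 * (Mf + L) * Mf)"
      using le Mf \<open>0 < Mf + L\<close> unfolding real num by (simp del: numeral_eq_ereal)
    then have "lam * (2 * (Mf + L) * Mf) \<le> \<delta>"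
      using Mf \<open>0 < Mf + L\<close> by (simp add: pos_le_divide_eq)
    then show thesis using that real Mf by (simp add: mult_ac)
  next
    case PInf
    then show thesis using le Mf \<open>0 < lam\<close> by simp
  next
    case MInf
    then show thesis using assms by simp
  qed
qed

section \<open>Runs of the two methods\<close>

lemma is_unique_minimizer_unique:
  assumes "is_unique_minimizer F a" "is_unique_minimizer F b"
  shows "a = b"
  using assms by (auto simp: is_unique_minimizer_def)

lemma cscs_run_unique:
  assumes "cscs_run f f' h x0 lam x" "cscs_run f f' h x0 lam y"
  shows "y = x"
proof
  fix j
  show "y j = x j"
  proof (induction j)
    case 0
    then show ?case using assms by (simp add: cscs_run_def)
  next
    case (Suc j)
    have min: "is_unique_minimizer
        (prox_add lam (w j) (\<lambda>u. linearization f f' (w j) u + h u)) (w (Suc j))"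
      if "cscs_run f f' h x0 lam w" for w
      using that unfolding cscs_run_def by (metis diff_Suc_1 le_add1 plus_1_eq_Suc)
    show ?case
      using min[OF assms(1)] min[OF assms(2)] Suc is_unique_minimizer_unique by metis
  qed
qed

lemma rpb_run_Suc:
  assumes "rpb_run f f' h x0 lam \<delta> x xc xt C"
  shows "is_arg_min (rpb_subproblem f f' h lam xc C (Suc j)) (\<lambda>_. True) (x (Suc j))"
    and "is_arg_min (rpb_phi f h lam xc (Suc j)) (\<lambda>u. u \<in> {x (Suc j), xt j}) (xt (Suc j))"
    and "rpb_serious f f' h lam \<delta> xc xt C (Suc j) \<Longrightarrow> finite (C (Suc (Suc j))) \<and>
      {x (Suc j)} \<subseteq> C (Suc (Suc j)) \<and> C (Suc (Suc j)) \<subseteq> x ` {0..Suc j} \<and> xc (Suc j) = x (Suc j)"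
proof -
  have "1 \<le> Suc j" by simp
  note rules = assms[unfolded rpb_run_def is_unique_minimizer_def,
      THEN conjunct2, THEN conjunct2, THEN conjunct2, THEN conjunct2, rule_format, OF this]
  show "is_arg_min (rpb_subproblem f f' h lam xc C (Suc j)) (\<lambda>_. True) (x (Suc j))"
    and "is_arg_min (rpb_phi f h lam xc (Suc j)) (\<lambda>u. u \<in> {x (Suc j), xt j}) (xt (Suc j))"
    and "rpb_serious f f' h lam \<delta> xc xt C (Suc j) \<Longrightarrow> finite (C (Suc (Suc j))) \<and>
      {x (Suc j)} \<subseteq> C (Suc (Suc j)) \<and> C (Suc (Suc j)) \<subseteq> x ` {0..Suc j} \<and> xc (Suc j) = x (Suc j)"
    using rules by simp_all
qed

text \<open>A serious iteration leaves behind exactly what the next one needs: a finite bundle in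
  \<open>dom h\<close> that contains the new prox-center.  So this is kept as an invariant.\<close>

lemma all_iterations_serious:
  fixes f h :: "'a::euclidean_space \<Rightarrow> ereal"
  assumes basic: "basic_assumptions f f' h Mf Mh \<mu>"
    and "x0 \<in> eff_dom h" "0 < lam" "0 < \<delta>"
    and le: "ereal lam \<le> ereal \<delta> / (2 * (ereal Mf + Mh) * ereal Mf)"
    and run: "rpb_run f f' h x0 lam \<delta> x xc xt C"
    and "1 \<le> j"
  shows "rpb_serious f f' h lam \<delta> xc xt C j"
proof -
  note b = basic_assumptionsD[OF basic]
  have r0: "x 0 = x0" "xc 0 = x0" "C 1 = {x0}"
    using run by (auto simp: rpb_run_def)
  note rmin = rpb_run_Suc(1)[OF run] and rt = rpb_run_Suc(2)[OF run] and rser = rpb_run_Suc(3)[OF run]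
  have step: "rpb_serious f f' h lam \<delta> xc xt C (Suc j) \<and> x (Suc j) \<in> eff_dom h"
    if C: "finite (C (Suc j))" "C (Suc j) \<subseteq> eff_dom h" "xc j \<in> C (Suc j)" for j
  proof
    have p: "is_arg_min (prox_add lam (xc j) (\<lambda>u. cut_model f f' (C (Suc j)) u + h u))
        (\<lambda>_. True) (x (Suc j))"
      using rmin[of j] by (simp add: rpb_subproblem_def)
    show "x (Suc j) \<in> eff_dom h"
      by (rule minimizer_in_eff_dom[OF basic \<open>0 < lam\<close> C p])
    have "rpb_gap f f' h lam xc xt C (Suc j)
        \<le> prox_add lam (xc j) (\<lambda>u. f u + h u) (x (Suc j))
          - (INF u. prox_add lam (xc j) (\<lambda>u. cut_model f f' (C (Suc j)) u + h u) u)"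
      using rt[of j]
      by (auto simp: rpb_gap_def rpb_subproblem_def rpb_phi_def is_arg_min_linorder
          intro!: ereal_minus_mono)
    also have "\<dots> \<le> ereal (2 * Mf * norm (x (Suc j) - xc j))"
      by (rule gap_le_step_length[OF basic \<open>0 < lam\<close> C p])
    also have "\<dots> \<le> ereal \<delta>"
    proof (cases rule: stepsize_cases[OF \<open>0 < lam\<close> \<open>0 < \<delta>\<close> b(1,2) le])
      case 1
      then show ?thesis using \<open>0 < \<delta>\<close> by simp
    next
      case (2 L)
      have "2 * Mf * norm (x (Suc j) - xc j) \<le> 2 * Mf * (lam * (Mf + L))"
        using minimizer_step_length[OF basic \<open>0 < lam\<close> C p \<open>Mh = ereal L\<close>] b(1)
        by (intro mult_left_mono) auto
      also have "\<dots> \<le> \<delta>" by (rule 2(3))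
      finally show ?thesis by simp
    qed
    finally show "rpb_serious f f' h lam \<delta> xc xt C (Suc j)"
      by (simp add: rpb_serious_def)
  qed
  have inv: "finite (C (Suc j)) \<and> C (Suc j) \<subseteq> eff_dom h \<and> xc j \<in> C (Suc j)
      \<and> x ` {0..j} \<subseteq> eff_dom h" for j
  proof (induction j)
    case 0
    then show ?case using r0 \<open>x0 \<in> eff_dom h\<close> by simp
  next
    case (Suc j)
    then have s: "rpb_serious f f' h lam \<delta> xc xt C (Suc j)" "x (Suc j) \<in> eff_dom h"
      using step by blast+
    then have "x ` {0..Suc j} \<subseteq> eff_dom h"
      using Suc by (auto simp: atLeastAtMostSuc_conv)
    then show ?case using rser[OF s(1)] by auto
  qed
  show ?thesis
    using step[of "j - 1"] inv[of "j - 1"] \<open>1 \<le> j\<close> by simp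
qed

lemma singleton_bundles_cscs_run:
  assumes run: "rpb_run f f' h x0 lam \<delta> x xc xt C"
    and ser: "\<And>j. 1 \<le> j \<Longrightarrow> rpb_serious f f' h lam \<delta> xc xt C j"
    and sing: "\<And>j. 1 \<le> j \<Longrightarrow> C (j + 1) = {x j}"
  shows "cscs_run f f' h x0 lam x"
  unfolding cscs_run_def
proof (intro conjI allI impI)
  show "x 0 = x0" using run by (simp add: rpb_run_def)
next
  fix j :: nat assume "1 \<le> j"
  have "C j = {x (j - 1)}" "xc (j - 1) = x (j - 1)"
    using run ser[of "j - 1"] sing[of "j - 1"] \<open>1 \<le> j\<close>
    by (cases "j = 1"; auto simp: rpb_run_def)+
  moreover have "is_unique_minimizer (rpb_subproblem f f' h lam xc C j) (x j)"
    using run \<open>1 \<le> j\<close> by (simp add: rpb_run_def)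
  ultimately show "is_unique_minimizer
      (prox_add lam (x (j - 1)) (\<lambda>u. linearization f f' (x (j - 1)) u + h u)) (x j)"
    by (simp add: rpb_subproblem_def cut_model_def)
qed

theorem proposition4p9:
  fixes f h :: "real ^ 'n \<Rightarrow> ereal" and f' :: "real ^ 'n \<Rightarrow> real ^ 'n"
    and Mf \<mu> lam \<delta> :: real and Mh M :: ereal and x0 :: "real ^ 'n"
    and x xc xt :: "nat \<Rightarrow> real ^ 'n" and C :: "nat \<Rightarrow> (real ^ 'n) set"
  assumes "basic_assumptions f f' h Mf Mh \<mu>"
    and "M = ereal Mf + Mh"
    and "x0 \<in> eff_dom h" and "lam > 0" and "\<delta> > 0"
    and "ereal lam \<le> ereal \<delta> / (2 * M * ereal Mf)"
    and "rpb_run f f' h x0 lam \<delta> x xc xt C"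
  shows "(Mf > 0 \<longrightarrow> Mh < \<infinity>) \<and>
    (\<forall>j\<ge>1. rpb_serious f f' h lam \<delta> xc xt C j) \<and>
    ((\<forall>j\<ge>1. rpb_serious f f' h lam \<delta> xc xt C j \<longrightarrow> C (j + 1) = {x j}) \<longrightarrow>
       (\<forall>y. cscs_run f f' h x0 lam y \<longleftrightarrow> y = x))"
proof (intro conjI)
  note le = assms(6)[unfolded assms(2)]
  show "Mf > 0 \<longrightarrow> Mh < \<infinity>"
    using stepsize_cases[OF assms(4,5) basic_assumptionsD(1,2)[OF assms(1)] le]
    by (metis less_ereal.simps(4) less_irrefl)
  show serious: "\<forall>j\<ge>1. rpb_serious f f' h lam \<delta> xc xt C j"
    using all_iterations_serious[OF assms(1,3,4,5) le assms(7)] by blast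
  show "(\<forall>j\<ge>1. rpb_serious f f' h lam \<delta> xc xt C j \<longrightarrow> C (j + 1) = {x j}) \<longrightarrow>
       (\<forall>y. cscs_run f f' h x0 lam y \<longleftrightarrow> y = x)"
    using singleton_bundles_cscs_run[OF assms(7)] cscs_run_unique serious by metis
qed

end
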